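(* Let $G$ be an $n \times n$ bipartite graph (with $n \geq 1$) and let $d \geq 0$ be an integer. Then \[ \beta_d(G) \geq \left\lfloor \frac{1}{2} \cdot \sum_{v \in V(G)} \min\left(1, \frac{d+1}{d(v)+1}\right) \right\rfloor, \] where $d(v)$ denotes the degree of $v$ in $G$.
   Context: An $n \times n$ bipartite graph is a bipartite graph $G=(A,B,E)$ with a fixed bipartition into parts $A$ and $B$ satisfying $|A|=|B|=n$. A graph $H$ is $d$-degenerate if every non-empty subgraph of $H$ contains a vertex of degree at most $d$. $\beta_d(G)$ denotes the largest $k$ for which there exist $X \subseteq A$ and $Y \subseteq B$ with $|X|=|Y|=k$ such that the subgraph of $G$ induced by $X \cup Y$ is $d$-degenerate (a $k \times k$ induced $d$-degenerate subgraph). *)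

theory Defs
  imports Complex_Main "Graph_Theory.Graph_Theory"
begin

text \<open>
  A finite simple undirected graph is, as everywhere in \<open>Graph_Theory\<close>, a symmetric loop-free
  digraph without parallel arcs (locale \<open>graph\<close>): an edge \<open>uv\<close> is the pair of arcs \<open>u \<rightarrow> v\<close>,
  \<open>v \<rightarrow> u\<close>. Each edge at \<open>v\<close> contributes exactly one arc with tail \<open>v\<close>, so the undirected
  degree is the out-degree.
\<close>

abbreviation degree :: "('a, 'b) pre_digraph \<Rightarrow> 'a \<Rightarrow> nat" where
  "degree G v \<equiv> out_degree G v"

definition bipartite_graph ::
  "nat \<Rightarrow> ('a, 'b) pre_digraph \<Rightarrow> 'a set \<Rightarrow> 'a set \<Rightarrow> bool" where
  "bipartite_graph n G A B \<longleftrightarrow>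
     graph G \<and> verts G = A \<union> B \<and> A \<inter> B = {} \<and> card A = n \<and> card B = n \<and>
     (\<forall>e \<in> arcs G. (tail G e \<in> A \<and> head G e \<in> B) \<or> (tail G e \<in> B \<and> head G e \<in> A))"

text \<open>
  The library's \<open>subgraph\<close> also admits non-symmetric sub-digraphs; \<open>graph H\<close> restricts the
  quantifier to undirected subgraphs.
\<close>

definition degenerate :: "nat \<Rightarrow> ('a, 'b) pre_digraph \<Rightarrow> bool" where
  "degenerate d G \<longleftrightarrow>
     (\<forall>H. graph H \<and> subgraph H G \<and> verts H \<noteq> {} \<longrightarrow> (\<exists>v \<in> verts H. degree H v \<le> d))"

text \<open>
  For a bipartite graph with finite parts the set below contains \<open>0\<close> and is bounded by
  \<open>card A\<close>, so the maximum is attained.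
\<close>

definition beta :: "nat \<Rightarrow> ('a, 'b) pre_digraph \<Rightarrow> 'a set \<Rightarrow> 'a set \<Rightarrow> nat" where
  "beta d G A B =
     Max {k. \<exists>X Y. X \<subseteq> A \<and> Y \<subseteq> B \<and> card X = k \<and> card Y = k \<and> degenerate d (G \<restriction> (X \<union> Y))}"

end

theory Submission
  imports Defs
begin

text \<open>
  Give a vertex of degree \<open>k\<close> the weight \<open>w k = min 1 ((d + 1) / (k + 1))\<close>, and let \<open>S W\<close> be the
  total weight of the graph induced by \<open>W\<close>. Vertices outside the core (the largest induced subgraph
  of minimum degree above \<open>d\<close>) can be kept without affecting degeneracy, and each weighs at most 1, so
  only the core matters. From a core, delete a vertex of maximum degree on either side, choosing the
  two vertices \<open>a\<close> and \<open>b\<close> non-adjacent if possible, and pass to the core again. Since \<open>w\<close> is convex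
  beyond \<open>d\<close> and \<open>p / (q (q + 1)) + q / (p (p + 1)) \<ge> 1 / (p + 1) + 1 / (q + 1)\<close>, the potential
  \<open>S W + w (deg a) + w (deg b)\<close> does not drop; and the remaining degrees of \<open>a\<close> and \<open>b\<close> still bound
  those on their sides, because \<open>a\<close> and \<open>b\<close> are adjacent only if all vertices of maximum degree on
  the two sides are. At the last step, where the core vanishes, one deletion may be saved, which
  leaves the two sides unbalanced by at most one. Thus more than \<open>S - 1\<close> vertices are kept, almost
  equally many on each side, and by integrality each side keeps at least \<open>\<lfloor>S / 2\<rfloor>\<close>.
\<close>

lemma ex_is_arg_max_if_finite:
  fixes f :: "'a \<Rightarrow> 'b :: linorder"
  assumes "finite S" "S \<noteq> {}"
  shows "\<exists>x. is_arg_max f (\<lambda>x. x \<in> S) x"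
  unfolding is_arg_max_linorder using assms by (metis Max_ge finite_imageI imageI obtains_MAX)


section \<open>Vertex weights\<close>

definition vertex_weight :: "nat \<Rightarrow> nat \<Rightarrow> real" where
  "vertex_weight d k = min 1 ((real d + 1) / (real k + 1))"

lemma vertex_weight_le_1: "vertex_weight d k \<le> 1"
  by (simp add: vertex_weight_def)

lemma vertex_weight_pos: "0 < vertex_weight d k"
  by (simp add: vertex_weight_def)

lemma vertex_weight_antimono: "k \<le> l \<Longrightarrow> vertex_weight d l \<le> vertex_weight d k"
  unfolding vertex_weight_def by (intro min.mono order.refl divide_left_mono) auto

lemma vertex_weight_eq: "d \<le> k \<Longrightarrow> vertex_weight d k = (real d + 1) / (real k + 1)"
  by (simp add: vertex_weight_def min_absorb2 divide_le_eq_1)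

lemma vertex_weight_diff:
  assumes "d < k"
  shows "vertex_weight d (k - 1) - vertex_weight d k = (real d + 1) / (real k * (real k + 1))"
  using assms by (simp add: vertex_weight_eq field_simps)

lemma vertex_weight_diff_antimono:
  assumes "d < k" "k \<le> m"
  shows "vertex_weight d (m - 1) - vertex_weight d m \<le> vertex_weight d (k - 1) - vertex_weight d k"
proof -
  have "(real d + 1) / (real m * (real m + 1)) \<le> (real d + 1) / (real k * (real k + 1))"
    using assms by (intro divide_left_mono mult_mono mult_pos_pos) auto
  then show ?thesis using assms by (subst (1 2) vertex_weight_diff) auto
qed

lemma sum_inverse_Suc_le_cross_sum:
  fixes p q :: real
  assumes "p > 0" "q > 0"
  shows "1 / (p + 1) + 1 / (q + 1) \<le> p / (q * (q + 1)) + q / (p * (p + 1))"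
proof -
  have "p / (q * (q + 1)) + q / (p * (p + 1)) - (1 / (p + 1) + 1 / (q + 1))
      = (p - q)\<^sup>2 * (p + q + 1) / (p * q * (p + 1) * (q + 1))"
    using assms by (simp add: divide_simps add_pos_pos) (simp add: algebra_simps power2_eq_square)
  moreover have "\<dots> \<ge> 0" using assms by simp
  ultimately show ?thesis by linarith
qed

lemma vertex_weight_add_le_cross_sum:
  assumes "d < p" "d < q"
  shows "vertex_weight d p + vertex_weight d q
    \<le> real p * (vertex_weight d (q - 1) - vertex_weight d q)
      + real q * (vertex_weight d (p - 1) - vertex_weight d p)"
proof -
  have "(real d + 1) * (1 / (real p + 1) + 1 / (real q + 1))
      \<le> (real d + 1) * (real p / (real q * (real q + 1)) + real q / (real p * (real p + 1)))"
    using assms by (intro mult_left_mono sum_inverse_Suc_le_cross_sum) auto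
  then show ?thesis
    unfolding vertex_weight_diff[OF assms(1)] vertex_weight_diff[OF assms(2)]
    using assms by (simp add: vertex_weight_eq algebra_simps)
qed


section \<open>Degrees, cores and weights of induced subgraphs\<close>

context graph
begin

definition degree_in :: "'a set \<Rightarrow> 'a \<Rightarrow> nat" where
  "degree_in W v = card {u \<in> W. v \<rightarrow>\<^bsub>G\<^esub> u}"

definition min_degree_gt :: "nat \<Rightarrow> 'a set \<Rightarrow> bool" where
  "min_degree_gt d W \<longleftrightarrow> (\<forall>v\<in>W. d < degree_in W v)"

text \<open>This is the \<open>(d + 1)\<close>-core in the usual numbering.\<close>

definition core :: "nat \<Rightarrow> 'a set \<Rightarrow> 'a set" where
  "core d U = \<Union> {H. H \<subseteq> U \<and> min_degree_gt d H}"

definition weight :: "nat \<Rightarrow> 'a set \<Rightarrow> real" where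
  "weight d W = (\<Sum>v\<in>W. vertex_weight d (degree_in W v))"

lemma adj_sym: "u \<rightarrow>\<^bsub>G\<^esub> v \<Longrightarrow> v \<rightarrow>\<^bsub>G\<^esub> u"
  by (rule arcs_ends_symmetric[OF sym_arcs])

lemma finite_subset_verts: "W \<subseteq> verts G \<Longrightarrow> finite W"
  by (rule finite_subset[OF _ finite_verts])

lemma finite_neighbours: "finite {u \<in> W. v \<rightarrow>\<^bsub>G\<^esub> u}"
  by (rule finite_subset_verts) (auto dest: adj_in_verts)

lemma degree_in_mono: "W \<subseteq> W' \<Longrightarrow> degree_in W v \<le> degree_in W' v"
  unfolding degree_in_def by (intro card_mono finite_neighbours) auto

lemma degree_in_le_card: "finite W \<Longrightarrow> degree_in W v \<le> card W"
  unfolding degree_in_def by (intro card_mono) auto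

lemma degree_in_Diff_singleton:
  assumes "x \<in> W"
  shows "degree_in (W - {x}) v = degree_in W v - (if v \<rightarrow>\<^bsub>G\<^esub> x then 1 else 0)"
proof -
  have "{u \<in> W - {x}. v \<rightarrow>\<^bsub>G\<^esub> u} = {u \<in> W. v \<rightarrow>\<^bsub>G\<^esub> u} - {x}" by auto
  then show ?thesis using assms finite_neighbours[of W v] by (auto simp: degree_in_def)
qed

lemma degree_in_Diff_self: "degree_in (W - {v}) v = degree_in W v"
proof -
  have "{u \<in> W - {v}. v \<rightarrow>\<^bsub>G\<^esub> u} = {u \<in> W. v \<rightarrow>\<^bsub>G\<^esub> u}" using adj_not_same by auto
  then show ?thesis by (simp add: degree_in_def)
qed

lemma degree_in_Diff_pair_le:
  assumes "b \<in> W" "degree_in W v \<le> degree_in W a"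
    and "a \<rightarrow>\<^bsub>G\<^esub> b \<Longrightarrow> degree_in W v = degree_in W a \<Longrightarrow> v \<rightarrow>\<^bsub>G\<^esub> b"
  shows "degree_in (W - {a, b}) v \<le> degree_in (W - {a, b}) a"
proof -
  have "W - {a, b} = W - {b} - {a}" by auto
  then have "degree_in (W - {a, b}) a = degree_in (W - {b}) a" by (simp add: degree_in_Diff_self)
  moreover have "degree_in (W - {a, b}) v \<le> degree_in (W - {b}) v" by (rule degree_in_mono) auto
  moreover have "degree_in (W - {b}) v \<le> degree_in (W - {b}) a"
    using assms by (cases "degree_in W v = degree_in W a") (auto simp: degree_in_Diff_singleton)
  ultimately show ?thesis by linarith
qed

lemma degree_induce_subgraph:
  assumes "v \<in> W"
  shows "degree (G \<restriction> W) v = degree_in W v"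
proof -
  have "bij_betw (head G) (out_arcs (G \<restriction> W) v) {u \<in> W. v \<rightarrow>\<^bsub>G\<^esub> u}"
  proof (rule bij_betw_imageI)
    show "inj_on (head G) (out_arcs (G \<restriction> W) v)"
      by (auto intro!: inj_onI no_multi_arcs simp: arc_to_ends_def)
    show "head G ` out_arcs (G \<restriction> W) v = {u \<in> W. v \<rightarrow>\<^bsub>G\<^esub> u}"
      using assms by (auto simp: arcs_ends_conv)
  qed
  then show ?thesis unfolding out_degree_def degree_in_def by (rule bij_betw_same_card)
qed

lemma degree_eq_degree_in_verts:
  assumes "v \<in> verts G"
  shows "degree G v = degree_in (verts G) v"
proof -
  have "out_arcs G v = out_arcs (G \<restriction> verts G) v" by auto
  then show ?thesis using degree_induce_subgraph[OF assms] by (simp add: out_degree_def)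
qed

lemma degree_subgraph_le:
  assumes "subgraph H G" "v \<in> verts H"
  shows "degree H v \<le> degree_in (verts H) v"
proof -
  have "out_arcs H v \<subseteq> out_arcs (G \<restriction> verts H) v"
    using subgraph_induce_subgraphI2[OF assms(1)] by (auto simp: subgraph_def compatible_def)
  moreover have "finite (out_arcs (G \<restriction> verts H) v)" by (simp add: out_arcs_def)
  ultimately show ?thesis
    unfolding degree_induce_subgraph[OF assms(2), symmetric] out_degree_def by (rule card_mono[rotated])
qed

lemma degenerate_induce_subgraph_iff:
  assumes "K \<subseteq> verts G"
  shows "degenerate d (G \<restriction> K) \<longleftrightarrow> (\<forall>H \<subseteq> K. min_degree_gt d H \<longrightarrow> H = {})"
proof
  assume degenerate: "degenerate d (G \<restriction> K)"
  show "\<forall>H \<subseteq> K. min_degree_gt d H \<longrightarrow> H = {}"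
  proof (intro allI impI, rule ccontr)
    fix H assume H: "H \<subseteq> K" "min_degree_gt d H" "H \<noteq> {}"
    have "induced_subgraph (G \<restriction> H) G" using H assms by (intro induced_induce) auto
    then have "graph (G \<restriction> H)"
      by (intro digraph.graphI digraphI_induced induced_graph_imp_symmetric[OF sym_arcs])
    moreover have "subgraph (G \<restriction> H) (G \<restriction> K)"
      using H by (auto intro!: subgraphI simp: compatible_def)
    ultimately obtain v where "v \<in> H" "degree (G \<restriction> H) v \<le> d"
      using degenerate H(3) unfolding degenerate_def by (metis induce_subgraph_verts)
    then show False using H(2) by (auto simp: degree_induce_subgraph min_degree_gt_def)
  qed
next
  assume no_dense: "\<forall>H \<subseteq> K. min_degree_gt d H \<longrightarrow> H = {}"
  show "degenerate d (G \<restriction> K)"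
    unfolding degenerate_def
  proof (intro allI impI)
    fix H assume H: "graph H \<and> subgraph H (G \<restriction> K) \<and> verts H \<noteq> {}"
    then have "subgraph H G"
      using subgraph_trans subgraph_induce_subgraphI[OF assms] by blast
    moreover have "verts H \<subseteq> K" using H by (auto simp: subgraph_def)
    then have "\<not> min_degree_gt d (verts H)" using H no_dense by auto
    ultimately show "\<exists>v \<in> verts H. degree H v \<le> d"
      unfolding min_degree_gt_def by (meson degree_subgraph_le not_less order_trans)
  qed
qed

lemma degenerate_induce_subset:
  assumes "degenerate d (G \<restriction> K)" "L \<subseteq> K" "K \<subseteq> verts G"
  shows "degenerate d (G \<restriction> L)"
  using assms by (simp add: degenerate_induce_subgraph_iff)

lemma core_subset: "core d U \<subseteq> U"
  by (auto simp: core_def)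

lemma subset_core: "H \<subseteq> U \<Longrightarrow> min_degree_gt d H \<Longrightarrow> H \<subseteq> core d U"
  by (auto simp: core_def)

lemma min_degree_gt_core: "min_degree_gt d (core d U)"
  unfolding min_degree_gt_def
proof
  fix v assume "v \<in> core d U"
  then obtain H where H: "v \<in> H" "H \<subseteq> U" "min_degree_gt d H" by (auto simp: core_def)
  then have "degree_in H v \<le> degree_in (core d U) v" by (intro degree_in_mono subset_core)
  then show "d < degree_in (core d U) v" using H by (auto simp: min_degree_gt_def)
qed

lemma degenerate_Un_Diff_core:
  assumes "degenerate d (G \<restriction> K)" "K \<subseteq> core d U" "U \<subseteq> verts G"
  shows "degenerate d (G \<restriction> (K \<union> (U - core d U)))"
proof -
  have K: "K \<subseteq> verts G" using assms core_subset by blast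
  have "H = {}" if "H \<subseteq> K \<union> (U - core d U)" "min_degree_gt d H" for H
  proof -
    have "H \<subseteq> core d U" using that assms core_subset by (intro subset_core) blast+
    then have "H \<subseteq> K" using that by auto
    then show ?thesis using that assms(1) by (simp add: degenerate_induce_subgraph_iff[OF K])
  qed
  then show ?thesis using K assms(3) by (subst degenerate_induce_subgraph_iff) auto
qed

lemma degenerate_if_core_empty:
  assumes "core d U = {}" "U \<subseteq> verts G"
  shows "degenerate d (G \<restriction> U)"
  using assms subset_core[of _ U d] by (simp add: degenerate_induce_subgraph_iff)

lemma weight_le_core:
  assumes "finite U"
  shows "weight d U \<le> real (card (U - core d U)) + weight d (core d U)"
proof -
  have "weight d U = (\<Sum>v\<in>U - core d U. vertex_weight d (degree_in U v))
      + (\<Sum>v\<in>core d U. vertex_weight d (degree_in U v))"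
    unfolding weight_def by (rule sum.subset_diff[OF core_subset assms])
  also have "\<dots> \<le> (\<Sum>v\<in>U - core d U. 1) + weight d (core d U)"
    unfolding weight_def
    by (intro add_mono sum_mono vertex_weight_le_1 vertex_weight_antimono degree_in_mono core_subset)
  finally show ?thesis by simp
qed

lemma weight_add_le_card:
  assumes W: "min_degree_gt d W" "2 * (d + 1) \<le> card W" and pq: "d < p" "d < q"
  shows "weight d W + vertex_weight d p + vertex_weight d q \<le> real (card W)"
proof -
  define t where "t = vertex_weight d (Suc d)"
  have t: "t = (real d + 1) / (real d + 2)" by (simp add: t_def vertex_weight_eq add.commute)
  have "weight d W \<le> (\<Sum>v\<in>W. t)"
    unfolding weight_def t_def using W(1)
    by (intro sum_mono vertex_weight_antimono) (auto simp: min_degree_gt_def Suc_le_eq)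
  moreover have "vertex_weight d p \<le> t" "vertex_weight d q \<le> t"
    unfolding t_def using pq by (auto intro!: vertex_weight_antimono)
  moreover have "(real (card W) + 2) * t \<le> real (card W)"
  proof -
    have "real (2 * (d + 1)) \<le> real (card W)" using W(2) by (rule of_nat_mono)
    then show ?thesis by (simp add: t divide_simps) (simp add: algebra_simps)
  qed
  ultimately show ?thesis by (simp add: algebra_simps)
qed

lemma sum_if_adj:
  fixes c :: real
  assumes "finite W"
  shows "(\<Sum>v\<in>W. if v \<rightarrow>\<^bsub>G\<^esub> x then c else 0) = real (degree_in W x) * c"
proof -
  have "(\<Sum>v\<in>W. if v \<rightarrow>\<^bsub>G\<^esub> x then c else 0) = (\<Sum>v\<in>{u \<in> W. x \<rightarrow>\<^bsub>G\<^esub> u}. c)"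
    using assms adj_sym by (intro sum.mono_neutral_cong_right) auto
  then show ?thesis by (simp add: degree_in_def)
qed

lemma weight_Diff_singleton_ge:
  assumes W: "finite W" "x \<in> W"
    and degrees: "\<And>v. v \<in> W \<Longrightarrow> v \<rightarrow>\<^bsub>G\<^esub> x \<Longrightarrow> d < degree_in W v \<and> degree_in W v \<le> m"
  shows "weight d W - vertex_weight d (degree_in W x)
      + real (degree_in W x) * (vertex_weight d (m - 1) - vertex_weight d m)
    \<le> weight d (W - {x})"
proof -
  define gain where "gain = vertex_weight d (m - 1) - vertex_weight d m"
  have "weight d W - vertex_weight d (degree_in W x) + real (degree_in W x) * gain
      = (\<Sum>v\<in>W - {x}. vertex_weight d (degree_in W v)) + real (degree_in (W - {x}) x) * gain"
    using W by (simp add: weight_def sum.remove degree_in_Diff_self)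
  also have "\<dots> = (\<Sum>v\<in>W - {x}. vertex_weight d (degree_in W v) + (if v \<rightarrow>\<^bsub>G\<^esub> x then gain else 0))"
    using W by (simp add: sum.distrib sum_if_adj)
  also have "\<dots> \<le> weight d (W - {x})"
    unfolding weight_def
  proof (rule sum_mono)
    fix v assume "v \<in> W - {x}"
    then show "vertex_weight d (degree_in W v) + (if v \<rightarrow>\<^bsub>G\<^esub> x then gain else 0)
        \<le> vertex_weight d (degree_in (W - {x}) v)"
      using W vertex_weight_diff_antimono[of d "degree_in W v" m] degrees[of v]
      by (cases "v \<rightarrow>\<^bsub>G\<^esub> x") (auto simp: degree_in_Diff_singleton gain_def)
  qed
  finally show ?thesis unfolding gain_def .
qed

lemma weight_le_delete_max_degree:
  assumes W: "finite W" "min_degree_gt d W" and x: "x \<in> W"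
    and max: "\<And>v. v \<in> W \<Longrightarrow> v \<rightarrow>\<^bsub>G\<^esub> x \<Longrightarrow> degree_in W v \<le> degree_in W x"
  shows "weight d W \<le> weight d (W - {x})"
proof -
  have "d < degree_in W x" using W(2) x by (auto simp: min_degree_gt_def)
  note vertex_weight_add_le_cross_sum[OF this this]
  moreover have "weight d W - vertex_weight d (degree_in W x) + real (degree_in W x)
      * (vertex_weight d (degree_in W x - 1) - vertex_weight d (degree_in W x)) \<le> weight d (W - {x})"
    using W x max by (intro weight_Diff_singleton_ge) (auto simp: min_degree_gt_def)
  ultimately show ?thesis by linarith
qed

lemma weight_potential_le_delete_pair:
  assumes W: "finite W" "min_degree_gt d W" and ab: "a \<in> W" "b \<in> W" "a \<noteq> b"
    and no_common: "\<And>v. v \<rightarrow>\<^bsub>G\<^esub> a \<Longrightarrow> \<not> v \<rightarrow>\<^bsub>G\<^esub> b"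
    and max_a: "\<And>v. v \<in> W \<Longrightarrow> v \<rightarrow>\<^bsub>G\<^esub> b \<Longrightarrow> degree_in W v \<le> degree_in W a"
    and max_b: "\<And>v. v \<in> W \<Longrightarrow> v \<rightarrow>\<^bsub>G\<^esub> a \<Longrightarrow> degree_in W v \<le> degree_in W b"
  shows "weight d W + vertex_weight d (degree_in W a) + vertex_weight d (degree_in W b)
    \<le> weight d (W - {a, b}) + vertex_weight d (degree_in (W - {a, b}) a)
      + vertex_weight d (degree_in (W - {a, b}) b)"
proof -
  let ?w = "vertex_weight d"
  define p q where "p = degree_in W a" and "q = degree_in W b"
  define p' q' where "p' = degree_in (W - {b}) a" and "q' = degree_in (W - {a}) b"
  have pq: "d < p" "d < q" using W(2) ab by (auto simp: min_degree_gt_def p_def q_def)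
  have eq: "W - {a} - {b} = W - {a, b}" "W - {b} - {a} = W - {a, b}" by auto
  have U: "degree_in (W - {a, b}) a = p'" "degree_in (W - {a, b}) b = q'"
    using degree_in_Diff_self[of "W - {b}" a] degree_in_Diff_self[of "W - {a}" b]
    by (simp_all add: eq p'_def q'_def)
  have p': "p' = (if a \<rightarrow>\<^bsub>G\<^esub> b then p - 1 else p)" and q': "q' = (if a \<rightarrow>\<^bsub>G\<^esub> b then q - 1 else q)"
    using ab adj_sym by (auto simp: p'_def q'_def p_def q_def degree_in_Diff_singleton)
  have delete_a: "weight d W - ?w p + real p * (?w (q - 1) - ?w q) \<le> weight d (W - {a})"
    unfolding p_def q_def using W ab max_b
    by (intro weight_Diff_singleton_ge) (auto simp: min_degree_gt_def)
  have "d < degree_in (W - {a}) v \<and> degree_in (W - {a}) v \<le> p" if "v \<in> W - {a}" "v \<rightarrow>\<^bsub>G\<^esub> b" for v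
    using that W ab max_a no_common[of v]
    by (auto simp: degree_in_Diff_singleton min_degree_gt_def p_def)
  then have delete_b:
    "weight d (W - {a}) - ?w q' + real q' * (?w (p - 1) - ?w p) \<le> weight d (W - {a, b})"
    unfolding q'_def eq(1)[symmetric] using W ab by (intro weight_Diff_singleton_ge) auto
  have "real q' * (?w (p - 1) - ?w p) = real q * (?w (p - 1) - ?w p) + ?w p - ?w p'"
    using pq by (simp add: p' q' algebra_simps)
  then show ?thesis
    using delete_a delete_b vertex_weight_add_le_cross_sum[OF pq]
    unfolding U p_def[symmetric] q_def[symmetric] by linarith
qed

end


section \<open>Balanced deletions in bipartite graphs\<close>

locale bipartition = graph +
  fixes A B :: "'a set"
  assumes verts_eq: "verts G = A \<union> B" and disjoint: "A \<inter> B = {}"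
    and adj_sides: "u \<rightarrow>\<^bsub>G\<^esub> v \<Longrightarrow> u \<in> A \<and> v \<in> B \<or> u \<in> B \<and> v \<in> A"
begin

definition nearly_balanced :: "'a set \<Rightarrow> bool" where
  "nearly_balanced D \<longleftrightarrow> \<bar>int (card (D \<inter> A)) - int (card (D \<inter> B))\<bar> \<le> 1"

definition retains :: "nat \<Rightarrow> 'a set \<Rightarrow> real \<Rightarrow> bool" where
  "retains d R x \<longleftrightarrow>
     (\<exists>K \<subseteq> R. degenerate d (G \<restriction> K) \<and> nearly_balanced (R - K) \<and> x \<le> real (card K))"

lemma finite_sides: "finite A" "finite B"
  using finite_subset_verts verts_eq by auto

lemma card_eq_card_sides:
  assumes "W \<subseteq> verts G"
  shows "card W = card (W \<inter> A) + card (W \<inter> B)"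
proof -
  have "card ((W \<inter> A) \<union> (W \<inter> B)) = card (W \<inter> A) + card (W \<inter> B)"
    using finite_sides disjoint by (intro card_Un_disjoint) auto
  moreover have "(W \<inter> A) \<union> (W \<inter> B) = W" using assms verts_eq by auto
  ultimately show ?thesis by simp
qed

lemma degree_in_le_card_side:
  shows "v \<in> A \<Longrightarrow> degree_in W v \<le> card (W \<inter> B)" "v \<in> B \<Longrightarrow> degree_in W v \<le> card (W \<inter> A)"
  unfolding degree_in_def using adj_sides[of v] disjoint finite_sides by (auto intro!: card_mono)

lemma card_sides_gt_min_degree:
  assumes "R \<subseteq> verts G" "min_degree_gt d R" "R \<noteq> {}"
  shows "d < card (R \<inter> A)" "d < card (R \<inter> B)"
proof -
  obtain v where v: "v \<in> R" using assms by auto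
  then have "degree_in R v \<noteq> 0" using assms(2) by (auto simp: min_degree_gt_def)
  then obtain u where "u \<in> R" "v \<rightarrow>\<^bsub>G\<^esub> u" by (auto simp: degree_in_def card_eq_0_iff)
  then obtain a b where "a \<in> R \<inter> A" "b \<in> R \<inter> B" using v adj_sides by blast
  then have "d < degree_in R a" "d < degree_in R b" "a \<in> A" "b \<in> B"
    using assms(2) by (auto simp: min_degree_gt_def)
  then show "d < card (R \<inter> A)" "d < card (R \<inter> B)"
    using degree_in_le_card_side[of _ R] by (meson less_le_trans)+
qed

lemma weight_add_le_card_if_nonempty:
  assumes R: "R \<subseteq> verts G" "min_degree_gt d R" "R \<noteq> {}" and pq: "d < p" "d < q"
  shows "weight d R + vertex_weight d p + vertex_weight d q \<le> real (card R)"
proof (rule weight_add_le_card[OF R(2) _ pq])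
  show "2 * (d + 1) \<le> card R"
    using card_sides_gt_min_degree[OF R] card_eq_card_sides[OF R(1)] by presburger
qed

lemma weight_add_le_card_delete_if_core_nonempty:
  assumes R: "R \<subseteq> verts G" "min_degree_gt d R" and x: "x \<in> R"
    and max: "\<And>v. v \<in> R \<Longrightarrow> v \<rightarrow>\<^bsub>G\<^esub> x \<Longrightarrow> degree_in R v \<le> degree_in R x"
    and nonempty: "core d (R - {x}) \<noteq> {}" and pq: "d < p" "d < q"
  shows "weight d R + vertex_weight d p + vertex_weight d q \<le> real (card (R - {x}))"
proof -
  define C where "C = core d (R - {x})"
  have fin: "finite R" using finite_subset_verts[OF R(1)] .
  have C: "C \<subseteq> R - {x}" unfolding C_def by (rule core_subset)
  have "weight d R \<le> weight d (R - {x})"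
    by (rule weight_le_delete_max_degree[OF fin R(2) x max])
  also have "\<dots> \<le> real (card (R - {x} - C)) + weight d C"
    unfolding C_def using fin by (intro weight_le_core) auto
  finally have "weight d R \<le> real (card (R - {x} - C)) + weight d C" .
  moreover have "weight d C + vertex_weight d p + vertex_weight d q \<le> real (card C)"
    using C R(1) nonempty min_degree_gt_core unfolding C_def
    by (intro weight_add_le_card_if_nonempty[OF _ _ _ pq]) auto
  moreover have "card (R - {x} - C) + card C = card (R - {x})"
    using C fin by (metis card_Diff_subset card_mono finite_Diff finite_subset le_add_diff_inverse2)
  ultimately show ?thesis by linarith
qed

lemma nearly_balanced_subset_singleton: "D \<subseteq> {x} \<Longrightarrow> nearly_balanced D"
  using disjoint by (cases "x \<in> A") (auto simp: nearly_balanced_def subset_singleton_iff Int_insert_left)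

lemma nearly_balanced_insert_pair:
  assumes "nearly_balanced D" "a \<in> A - D" "b \<in> B - D"
  shows "nearly_balanced (insert a (insert b D))"
proof -
  have "insert a (insert b D) \<inter> A = insert a (D \<inter> A)" "insert a (insert b D) \<inter> B = insert b (D \<inter> B)"
    using assms disjoint by auto
  then show ?thesis using assms finite_sides by (simp add: nearly_balanced_def)
qed

lemma retains_mono: "retains d R y \<Longrightarrow> x \<le> y \<Longrightarrow> retains d R x"
  unfolding retains_def by (meson order_trans)

lemma retains_card_if_core_empty:
  assumes "core d U = {}" "U \<subseteq> verts G"
  shows "retains d U (real (card U))"
  unfolding retains_def using degenerate_if_core_empty[OF assms]
  by (intro exI[of _ U]) (simp add: nearly_balanced_def)

lemma retains_delete_vertex_if_core_empty:
  assumes "core d (R - {x}) = {}" "R \<subseteq> verts G" "x \<in> R"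
  shows "retains d R (real (card R) - 1)"
proof -
  have "degenerate d (G \<restriction> (R - {x}))" using assms by (intro degenerate_if_core_empty) auto
  moreover have "nearly_balanced (R - (R - {x}))" by (rule nearly_balanced_subset_singleton) auto
  moreover have "real (card R) - 1 \<le> real (card (R - {x}))"
    using assms by (simp add: card_Diff_singleton)
  ultimately show ?thesis unfolding retains_def by blast
qed

lemma retains_delete_pair:
  assumes "retains d (R - {a, b}) x" "a \<in> R \<inter> A" "b \<in> R \<inter> B"
  shows "retains d R x"
proof -
  obtain K where K: "K \<subseteq> R - {a, b}" "degenerate d (G \<restriction> K)" "nearly_balanced (R - {a, b} - K)"
      "x \<le> real (card K)"
    using assms(1) unfolding retains_def by blast
  have "R - K = insert a (insert b (R - {a, b} - K))" using K(1) assms by auto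
  then have "nearly_balanced (R - K)"
    using nearly_balanced_insert_pair[OF K(3)] assms by simp
  then show ?thesis using K unfolding retains_def by blast
qed

lemma retains_if_core_retains:
  assumes "retains d (core d U) x" "U \<subseteq> verts G"
  shows "retains d U (weight d U - weight d (core d U) + x)"
proof -
  obtain K where K: "K \<subseteq> core d U" "degenerate d (G \<restriction> K)" "nearly_balanced (core d U - K)"
      "x \<le> real (card K)"
    using assms(1) unfolding retains_def by blast
  have U: "finite U" "core d U \<subseteq> U" using assms(2) finite_subset_verts core_subset by auto
  define L where "L = K \<union> (U - core d U)"
  have "degenerate d (G \<restriction> L)"
    unfolding L_def using K assms(2) by (intro degenerate_Un_Diff_core)
  moreover have "U - L = core d U - K" using K(1) U(2) by (auto simp: L_def)
  moreover have "card L = card K + card (U - core d U)"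
    unfolding L_def using K(1) U by (intro card_Un_disjoint) (auto intro: finite_subset)
  moreover have "L \<subseteq> U" using K(1) U(2) by (auto simp: L_def)
  ultimately show ?thesis
    using K weight_le_core[OF U(1), of d] unfolding retains_def by (intro exI[of _ L]) auto
qed

lemma retains_weight_if_core_delete_pair_empty:
  assumes R: "R \<subseteq> verts G" "min_degree_gt d R" "R \<noteq> {}" and pq: "d < p" "d < q"
    and ab: "a \<in> R \<inter> A" "b \<in> R \<inter> B" and empty: "core d (R - {a, b}) = {}"
  shows "retains d R (weight d R + vertex_weight d p + vertex_weight d q - 1)"
proof -
  have fin: "finite R" using finite_subset_verts[OF R(1)] .
  then obtain x where x: "x \<in> R" "\<And>v. v \<in> R \<Longrightarrow> degree_in R v \<le> degree_in R x"
    using R(3) ex_is_arg_max_if_finite[of R "degree_in R"] by (auto simp: is_arg_max_linorder)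
  show ?thesis
  proof (cases "core d (R - {x}) = {}")
    case True
    have "weight d R + vertex_weight d p + vertex_weight d q - 1 \<le> real (card R) - 1"
      using weight_add_le_card_if_nonempty[OF R pq] by simp
    with retains_delete_vertex_if_core_empty[OF True R(1) x(1)] show ?thesis by (rule retains_mono)
  next
    case False
    have "a \<noteq> b" using ab disjoint by auto
    then have "card (R - {x}) = Suc (card (R - {a, b}))"
      using x(1) ab fin card_mono[of R "{a, b}"] by (simp add: card_Diff_subset)
    moreover have "weight d R + vertex_weight d p + vertex_weight d q \<le> real (card (R - {x}))"
      using x by (intro weight_add_le_card_delete_if_core_nonempty[OF R(1,2) _ _ False pq])
    ultimately have
      "weight d R + vertex_weight d p + vertex_weight d q - 1 \<le> real (card (R - {a, b}))"
      by linarith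
    moreover have "retains d (R - {a, b}) (real (card (R - {a, b})))"
      using empty R(1) by (intro retains_card_if_core_empty) auto
    ultimately show ?thesis by (intro retains_delete_pair[OF _ ab]) (rule retains_mono)
  qed
qed

lemma exists_max_degree_pair:
  assumes "finite R" "R \<inter> A \<noteq> {}" "R \<inter> B \<noteq> {}"
  obtains a b where
    "is_arg_max (degree_in R) (\<lambda>v. v \<in> R \<inter> A) a" "is_arg_max (degree_in R) (\<lambda>v. v \<in> R \<inter> B) b"
    "\<And>u v. a \<rightarrow>\<^bsub>G\<^esub> b \<Longrightarrow> is_arg_max (degree_in R) (\<lambda>v. v \<in> R \<inter> A) u \<Longrightarrow>
       is_arg_max (degree_in R) (\<lambda>v. v \<in> R \<inter> B) v \<Longrightarrow> u \<rightarrow>\<^bsub>G\<^esub> v"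
proof -
  obtain a b where ab: "is_arg_max (degree_in R) (\<lambda>v. v \<in> R \<inter> A) a"
      "is_arg_max (degree_in R) (\<lambda>v. v \<in> R \<inter> B) b"
    using assms ex_is_arg_max_if_finite[of "R \<inter> A" "degree_in R"]
      ex_is_arg_max_if_finite[of "R \<inter> B" "degree_in R"] by auto
  show thesis
  proof (cases "\<exists>u v. is_arg_max (degree_in R) (\<lambda>v. v \<in> R \<inter> A) u \<and>
      is_arg_max (degree_in R) (\<lambda>v. v \<in> R \<inter> B) v \<and> \<not> u \<rightarrow>\<^bsub>G\<^esub> v")
    case True
    then show thesis using that by blast
  next
    case False
    then show thesis using that[OF ab] by blast
  qed
qed

lemma exists_deletion_pair:
  assumes R: "R \<subseteq> verts G" "min_degree_gt d R" "R \<noteq> {}"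
    and max_A: "\<And>v. v \<in> R \<inter> A \<Longrightarrow> degree_in R v \<le> p"
    and max_B: "\<And>v. v \<in> R \<inter> B \<Longrightarrow> degree_in R v \<le> q"
  obtains a b p' q' where "a \<in> R \<inter> A" "b \<in> R \<inter> B"
    "\<And>v. v \<in> (R - {a, b}) \<inter> A \<Longrightarrow> degree_in (R - {a, b}) v \<le> p'"
    "\<And>v. v \<in> (R - {a, b}) \<inter> B \<Longrightarrow> degree_in (R - {a, b}) v \<le> q'"
    "weight d R + vertex_weight d p + vertex_weight d q
      \<le> weight d (R - {a, b}) + vertex_weight d p' + vertex_weight d q'"
proof -
  have fin: "finite R" using finite_subset_verts[OF R(1)] .
  have sides: "R \<inter> A \<noteq> {}" "R \<inter> B \<noteq> {}" using card_sides_gt_min_degree[OF R] by auto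
  obtain a b where arg_max: "is_arg_max (degree_in R) (\<lambda>v. v \<in> R \<inter> A) a"
      "is_arg_max (degree_in R) (\<lambda>v. v \<in> R \<inter> B) b"
    and complete: "\<And>u v. a \<rightarrow>\<^bsub>G\<^esub> b \<Longrightarrow> is_arg_max (degree_in R) (\<lambda>v. v \<in> R \<inter> A) u \<Longrightarrow>
       is_arg_max (degree_in R) (\<lambda>v. v \<in> R \<inter> B) v \<Longrightarrow> u \<rightarrow>\<^bsub>G\<^esub> v"
    using exists_max_degree_pair[OF fin sides] by metis
  then have a: "a \<in> R \<inter> A" "\<And>v. v \<in> R \<inter> A \<Longrightarrow> degree_in R v \<le> degree_in R a"
    and b: "b \<in> R \<inter> B" "\<And>v. v \<in> R \<inter> B \<Longrightarrow> degree_in R v \<le> degree_in R b"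
    by (auto simp: is_arg_max_linorder)
  define U where "U = R - {a, b}"
  have "degree_in U v \<le> degree_in U a" if "v \<in> U \<inter> A" for v
    unfolding U_def using that a b complete[OF _ _ arg_max(2)]
    by (intro degree_in_Diff_pair_le) (auto simp: is_arg_max_linorder U_def)
  moreover have "degree_in U v \<le> degree_in U b" if "v \<in> U \<inter> B" for v
    unfolding U_def insert_commute[of a b] using that a b complete[OF _ arg_max(1)] adj_sym
    by (intro degree_in_Diff_pair_le) (auto simp: is_arg_max_linorder U_def)
  moreover have "weight d R + vertex_weight d (degree_in R a) + vertex_weight d (degree_in R b)
      \<le> weight d U + vertex_weight d (degree_in U a) + vertex_weight d (degree_in U b)"
    unfolding U_def using a b disjoint adj_sides
    by (intro weight_potential_le_delete_pair[OF fin R(2)]) blast+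
  moreover have "vertex_weight d p \<le> vertex_weight d (degree_in R a)"
      "vertex_weight d q \<le> vertex_weight d (degree_in R b)"
    using max_A[OF a(1)] max_B[OF b(1)] by (auto intro: vertex_weight_antimono)
  ultimately show thesis using that[of a b "degree_in U a" "degree_in U b"] a(1) b(1)
    unfolding U_def by auto
qed

lemma retains_weight_if_min_degree_gt:
  assumes "R \<subseteq> verts G" "min_degree_gt d R" "R \<noteq> {}"
    and "\<And>v. v \<in> R \<inter> A \<Longrightarrow> degree_in R v \<le> p" and "\<And>v. v \<in> R \<inter> B \<Longrightarrow> degree_in R v \<le> q"
  shows "retains d R (weight d R + vertex_weight d p + vertex_weight d q - 1)"
  using assms
proof (induction "card R" arbitrary: R p q rule: less_induct)
  case less
  note R = less.prems(1-3)
  obtain a b p' q' where ab: "a \<in> R \<inter> A" "b \<in> R \<inter> B"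
    and max_A: "\<And>v. v \<in> (R - {a, b}) \<inter> A \<Longrightarrow> degree_in (R - {a, b}) v \<le> p'"
    and max_B: "\<And>v. v \<in> (R - {a, b}) \<inter> B \<Longrightarrow> degree_in (R - {a, b}) v \<le> q'"
    and potential: "weight d R + vertex_weight d p + vertex_weight d q
      \<le> weight d (R - {a, b}) + vertex_weight d p' + vertex_weight d q'"
    using exists_deletion_pair[OF less.prems] by metis
  define U where "U = R - {a, b}"
  show ?case
  proof (cases "core d U = {}")
    case True
    have "d < p" "d < q"
      using R(2) ab less.prems(4)[OF ab(1)] less.prems(5)[OF ab(2)]
      by (auto simp: min_degree_gt_def intro: less_le_trans)
    then show ?thesis
      using retains_weight_if_core_delete_pair_empty[OF R _ _ ab] True by (simp add: U_def)
  next
    case False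
    have C: "core d U \<subseteq> U" by (rule core_subset)
    have "card (core d U) < card R"
      using C ab finite_subset_verts[OF R(1)] by (intro psubset_card_mono) (auto simp: U_def)
    moreover have "degree_in (core d U) v \<le> p'" if "v \<in> core d U \<inter> A" for v
      using that C max_A degree_in_mono[OF C, of v] unfolding U_def
      by (meson IntE IntI order_trans subsetD)
    moreover have "degree_in (core d U) v \<le> q'" if "v \<in> core d U \<inter> B" for v
      using that C max_B degree_in_mono[OF C, of v] unfolding U_def
      by (meson IntE IntI order_trans subsetD)
    moreover have U: "U \<subseteq> verts G" using R(1) by (auto simp: U_def)
    ultimately have
      "retains d (core d U) (weight d (core d U) + vertex_weight d p' + vertex_weight d q' - 1)"
      using C False by (intro less.hyps min_degree_gt_core) auto
    from retains_if_core_retains[OF this U]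
    have "retains d U (weight d R + vertex_weight d p + vertex_weight d q - 1)"
      by (rule retains_mono) (use potential in \<open>simp add: U_def\<close>)
    then show ?thesis unfolding U_def using ab by (rule retains_delete_pair)
  qed
qed

lemma retains_gt_weight_minus_1:
  obtains x where "weight d (verts G) - 1 < x" "retains d (verts G) x"
proof (cases "core d (verts G) = {}")
  case True
  then have "weight d (verts G) - 1 < real (card (verts G))"
    using weight_le_core[OF finite_verts, of d] by (simp add: weight_def)
  then show thesis using that retains_card_if_core_empty[OF True] by blast
next
  case False
  define C m where "C = core d (verts G)" and "m = card C"
  have C: "C \<subseteq> verts G" unfolding C_def by (rule core_subset)
  have "retains d C (weight d C + vertex_weight d m + vertex_weight d m - 1)"
    unfolding m_def using C False min_degree_gt_core finite_subset_verts[OF C]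
    by (intro retains_weight_if_min_degree_gt degree_in_le_card) (auto simp: C_def)
  from retains_if_core_retains[OF this[unfolded C_def] order.refl]
  have "retains d (verts G) (weight d (verts G) + 2 * vertex_weight d m - 1)"
    by (rule retains_mono) simp
  then show thesis using vertex_weight_pos[of d m] by (intro that) auto
qed

lemma exists_balanced_degenerate:
  assumes sides: "card A = card B" and k: "2 * real k \<le> weight d (verts G)"
  obtains X Y where "X \<subseteq> A" "Y \<subseteq> B" "card X = k" "card Y = k" "degenerate d (G \<restriction> (X \<union> Y))"
proof -
  obtain K where K: "K \<subseteq> verts G" "degenerate d (G \<restriction> K)" "nearly_balanced (verts G - K)"
      "weight d (verts G) - 1 < real (card K)"
    using retains_gt_weight_minus_1[of d] unfolding retains_def by (metis less_le_trans)
  have "2 * k \<le> card (K \<inter> A) + card (K \<inter> B)"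
    using K(4) k card_eq_card_sides[OF K(1)] by linarith
  moreover have "card (K \<inter> A) \<le> card A" "card (K \<inter> B) \<le> card B"
    using finite_sides by (auto intro: card_mono)
  moreover have "(verts G - K) \<inter> A = A - K \<inter> A" "(verts G - K) \<inter> B = B - K \<inter> B"
    using verts_eq by auto
  then have "\<bar>int (card A - card (K \<inter> A)) - int (card B - card (K \<inter> B))\<bar> \<le> 1"
    using K(3) finite_sides by (simp add: nearly_balanced_def card_Diff_subset)
  ultimately have "k \<le> card (K \<inter> A)" "k \<le> card (K \<inter> B)" using sides by linarith+
  then obtain X Y where XY: "X \<subseteq> K \<inter> A" "card X = k" "Y \<subseteq> K \<inter> B" "card Y = k"
    by (metis obtain_subset_with_card_n)
  moreover have "degenerate d (G \<restriction> (X \<union> Y))"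
    using XY by (intro degenerate_induce_subset[OF K(2) _ K(1)]) auto
  ultimately show thesis using that by blast
qed

lemma le_beta:
  assumes "X \<subseteq> A" "Y \<subseteq> B" "card X = k" "card Y = k" "degenerate d (G \<restriction> (X \<union> Y))"
  shows "k \<le> beta d G A B"
proof -
  have "finite {k. \<exists>X Y. X \<subseteq> A \<and> Y \<subseteq> B \<and> card X = k \<and> card Y = k \<and>
      degenerate d (G \<restriction> (X \<union> Y))}"
    by (rule finite_subset[of _ "{..card A}"]) (auto intro: card_mono finite_sides)
  then show ?thesis unfolding beta_def using assms by (intro Max_ge) auto
qed

end

lemma bipartition_if_bipartite_graph:
  assumes "bipartite_graph n G A B"
  shows "bipartition G A B"
proof -
  interpret graph G using assms by (simp add: bipartite_graph_def)
  show ?thesis by unfold_locales (use assms in \<open>auto simp: bipartite_graph_def arcs_ends_conv\<close>)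
qed

theorem theorem6:
  fixes G :: "('a, 'b) pre_digraph" and A B :: "'a set" and n d :: nat
  assumes "bipartite_graph n G A B" and "n \<ge> 1"
  shows "int (beta d G A B) \<ge>
    \<lfloor>(1 / 2 :: real) * (\<Sum>v \<in> verts G. min 1 ((real d + 1) / (real (degree G v) + 1)))\<rfloor>"
proof -
  interpret bipartition G A B using assms(1) by (rule bipartition_if_bipartite_graph)
  define s where "s = (\<Sum>v \<in> verts G. min 1 ((real d + 1) / (real (degree G v) + 1)))"
  define k where "k = nat \<lfloor>1 / 2 * s\<rfloor>"
  have "0 \<le> s" unfolding s_def by (intro sum_nonneg) auto
  then have k: "int k = \<lfloor>1 / 2 * s\<rfloor>" by (simp add: k_def)
  have "s = weight d (verts G)"
    by (simp add: s_def weight_def vertex_weight_def degree_eq_degree_in_verts)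
  with k have "2 * real k \<le> weight d (verts G)" by linarith
  moreover have "card A = card B" using assms(1) by (simp add: bipartite_graph_def)
  ultimately obtain X Y where
    "X \<subseteq> A" "Y \<subseteq> B" "card X = k" "card Y = k" "degenerate d (G \<restriction> (X \<union> Y))"
    using exists_balanced_degenerate by metis
  then have "k \<le> beta d G A B" by (rule le_beta)
  then show ?thesis using k unfolding s_def by linarith
qed

end
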